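(* Let $t$ be a positive integer and let $G=(V,E)$ be a finite undirected graph with $|V|$ odd and with edge expansion $c > t+1$. Then the Tseitin polytope $P_{TS(G)}$ has $t$-dimensional lattice rank at least $\frac{c-(t+1)}{2t}|V|$. If, moreover, $G$ is $d$-regular, then the $t$-dimensional lattice rank of $P_{TS(G)}$ is at least $\frac{c-(t+1)}{dt}|E|$.
   Context: Edge expansion: for disjoint $V_1,V_2\subseteq V$ let $e_G(V_1,V_2)$ be the number of edges of $G$ with one endpoint in each of $V_1$ and $V_2$. The edge expansion of $G$ is $\min \frac{e_G(S,V\setminus S)}{|S|}$, the minimum being over all nonempty $S\subseteq V$ with $|S|\le |V|/2$. Tseitin polytope: for $u\in V$ let $N(u)=\{v\in V: uv\in E\}$. The Tseitin polytope $P_{TS(G)}\subseteq[0,1]^{|E|}$ (variables $x_{uv}$ indexed by the edges $uv\in E$) is described by the inequalities $\sum_{v\in N(u)\setminus F} x_{uv}+\sum_{v\in F}(1-x_{uv})\ge 1$ for all $u\in V$ and all $F\subseteq N(u)$ with $|F|$ even, together with $0\le x_{uv}\le 1$ for all $uv\in E$. Lattice closure and rank: for $P\subseteq\mathbb{R}^n$, the $t$-dimensional lattice closure of $P$ is $$tLC(P)=\bigcap_{\pi^1,\dots,\pi^t\in\mathbb{Z}^n}\mathrm{conv}\Big(\bigcap_{j=1}^t\{x\in P:\pi^j x\in\mathbb{Z}\}\Big),$$ where $\pi x$ denotes the inner product of $\pi$ and $x$. Put $tLC^0(P)=P$ and $tLC^k(P)=tLC(tLC^{k-1}(P))$ for $k\ge1$.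 Let $P_I$ denote the integer hull of $P$, i.e. the convex hull of the integral points of $P$. The $t$-dimensional lattice rank of $P$ is the minimum $k\ge0$ such that $tLC^k(P)=P_I$. *)

theory Defs
  imports "HOL-Analysis.Analysis" "HOL-Library.Extended_Nat" "HOL-Library.Extended_Real"
begin

definition simple_graph :: "'v set \<Rightarrow> 'v set set \<Rightarrow> bool" where
  "simple_graph V E \<longleftrightarrow> finite V \<and> (\<forall>e\<in>E. e \<subseteq> V \<and> card e = 2)"

definition nbrs :: "'v set \<Rightarrow> 'v set set \<Rightarrow> 'v \<Rightarrow> 'v set" where
  "nbrs V E u = {v \<in> V. {u, v} \<in> E}"

definition regular_graph :: "'v set \<Rightarrow> 'v set set \<Rightarrow> nat \<Rightarrow> bool" where
  "regular_graph V E d \<longleftrightarrow> (\<forall>u\<in>V. card (nbrs V E u) = d)"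

definition edges_between :: "'v set set \<Rightarrow> 'v set \<Rightarrow> 'v set \<Rightarrow> nat" where
  "edges_between E A B = card {e \<in> E. \<exists>u\<in>A. \<exists>v\<in>B. e = {u, v}}"

(* Meaningful only for card V \<ge> 2; otherwise the minimum ranges over the empty set. *)
definition edge_expansion :: "'v set \<Rightarrow> 'v set set \<Rightarrow> real" where
  "edge_expansion V E =
     Min {real (edges_between E S (V - S)) / real (card S) | S.
            S \<subseteq> V \<and> S \<noteq> {} \<and> real (card S) \<le> real (card V) / 2}"

(* idx identifies the edge set E with the coordinate type 'n of the ambient space (it is used
   with bij_betw idx E UNIV), so the variable of the edge uv is the coordinate idx {u, v}. *)
definition tseitin_polytope ::
  "'v set \<Rightarrow> 'v set set \<Rightarrow> ('v set \<Rightarrow> 'n) \<Rightarrow> (real ^ 'n::finite) set" where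
  "tseitin_polytope V E idx =
     {x. (\<forall>u\<in>V. \<forall>F. F \<subseteq> nbrs V E u \<and> even (card F) \<longrightarrow>
            (\<Sum>v \<in> nbrs V E u - F. x $ idx {u, v}) + (\<Sum>v\<in>F. 1 - x $ idx {u, v}) \<ge> 1)
       \<and> (\<forall>e\<in>E. 0 \<le> x $ idx e \<and> x $ idx e \<le> 1)}"

definition integral_vec :: "real ^ 'n::finite \<Rightarrow> bool" where
  "integral_vec x \<longleftrightarrow> (\<forall>i. x $ i \<in> \<int>)"

definition integer_hull :: "(real ^ 'n::finite) set \<Rightarrow> (real ^ 'n) set" where
  "integer_hull P = convex hull {x \<in> P. integral_vec x}"

(* Only the values \<pi> 1, ..., \<pi> t of the sequence \<pi> matter; intended for t \<ge> 1. *)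
definition lattice_closure :: "nat \<Rightarrow> (real ^ 'n::finite) set \<Rightarrow> (real ^ 'n) set" where
  "lattice_closure t P =
     (\<Inter>\<pi> \<in> {\<pi> :: nat \<Rightarrow> real ^ 'n. \<forall>j\<in>{1..t}. integral_vec (\<pi> j)}.
        convex hull (\<Inter>j\<in>{1..t}. {x \<in> P. \<pi> j \<bullet> x \<in> \<int>}))"

(* The infimum of a nonempty set in enat is its minimum; the value is \<infinity> if no iterate
   equals the integer hull. *)
definition lattice_rank :: "nat \<Rightarrow> (real ^ 'n::finite) set \<Rightarrow> enat" where
  "lattice_rank t P = (INF k \<in> {k. (lattice_closure t ^^ k) P = integer_hull P}. enat k)"

end

theory Submission
  imports Defs
begin

text \<open>
  A 0/1 point of the Tseitin polytope is an edge set in which every vertex of \<open>G\<close> has odd degree.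
  The degrees of an edge set add up to an even number, so for \<open>|V|\<close> odd the integer hull is empty
  (\<open>integer_hull_empty\<close>), and the rank exceeds every \<open>k\<close> such that the first \<open>k\<close> closures are
  all nonempty. The proof follows a half-integral point through the rounds.

  Consider points with entries 0, 1/2, 1, and let \<open>H\<close> be the set of edges with value 1/2. Such a
  point lies in the polytope if every vertex either meets at least two edges of \<open>H\<close>, or meets none
  and has odd degree in the set of ones. Given \<open>t\<close> integral vectors, linear algebra over the field
  with two elements yields a set \<open>D \<subseteq> H\<close> of at most \<open>t\<close> edges such that every one of the vectors
  has an even sum over \<open>H - D\<close> (\<open>exists_small_subset_even_rest\<close>). Rounding \<open>D\<close> to all ones and to
  all zeros gives two points whose midpoint is the original one and on which all \<open>t\<close> inner products
  are integers. So the original point survives a round as soon as the two new points lie in the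
  previous closure (\<open>state_survives_round\<close>), and the price is \<open>t\<close> half edges.

  If all cuts of \<open>H\<close> had at least \<open>t + 2\<close> edges before the round, then all cuts have at least 2
  edges after it, which is enough for membership in the polytope but not for another round. The cuts
  are repaired by giving up vertices: the half edges outside a smaller vertex set \<open>A'\<close>
  are rounded in all ways that give the vertices of \<open>A - A'\<close> odd degree. Since every edge
  lies on a cycle (in the graph with \<open>A'\<close> contracted to a point), each edge is 1 in exactly half of
  these roundings, so their average is the old point (\<open>state_in_hull_of_core_states\<close>); closures are
  convex, so it suffices to continue with each rounding separately.

  How large can \<open>A'\<close> be chosen? As long as the current set has a cut with at most \<open>t + 1\<close> half edges,
  one side of it is split off. Every split loses at most \<open>t + 1\<close> half edges and at least one vertex,
  while the rounds so far lost \<open>t\<close> half edges each, say \<open>f\<close> together. If this procedure ended with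
  all parts of size at most \<open>|V| / 2\<close>, then edge expansion, summed over the parts, would
  force about \<open>c |V| / 2 \<le> f + (t + 1) |V| / 2\<close>. So it stops earlier, with more than half of the
  vertices in \<open>A'\<close>, as long as \<open>f + t < (c - (t + 1)) |V| / 2\<close>
  (\<open>exists_core\<close>). Dividing by the \<open>t\<close> edges per round gives the rank bound. In a \<open>d\<close>-regular
  graph \<open>d |V| = 2 |E|\<close>, which turns the first bound into the second.
\<close>

section \<open>Parity of edge sets\<close>

definition cut :: "'v set set \<Rightarrow> 'v set \<Rightarrow> 'v set set" where
  "cut H S = {e \<in> H. e \<inter> S \<noteq> {} \<and> \<not> e \<subseteq> S}"

definition odd_at :: "'v set set \<Rightarrow> 'v \<Rightarrow> bool" where
  "odd_at J v \<longleftrightarrow> odd (card {e \<in> J. v \<in> e})"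

lemma odd_card_sym_diff:
  assumes "finite X" "finite Y"
  shows "odd (card (sym_diff X Y)) \<longleftrightarrow> odd (card X) \<noteq> odd (card Y)"
proof -
  have "card (sym_diff X Y) = card (X - Y) + card (Y - X)"
    by (rule card_Un_disjoint) (use assms in auto)
  moreover have "card X = card (X - Y) + card (X \<inter> Y)"
    using card_Int_Diff[OF assms(1), of Y] by simp
  moreover have "card Y = card (Y - X) + card (X \<inter> Y)"
    using card_Int_Diff[OF assms(2), of X] by (simp add: Int_commute)
  ultimately show ?thesis by auto
qed

lemma odd_at_sym_diff:
  assumes "finite J" "finite K"
  shows "odd_at (sym_diff J K) v \<longleftrightarrow> odd_at J v \<noteq> odd_at K v"
proof -
  have "{e \<in> sym_diff J K. v \<in> e} = sym_diff {e \<in> J. v \<in> e} {e \<in> K. v \<in> e}"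
    by auto
  then show ?thesis
    unfolding odd_at_def using odd_card_sym_diff[of "{e \<in> J. v \<in> e}" "{e \<in> K. v \<in> e}"] assms
    by simp
qed

lemma odd_at_empty [simp]: "\<not> odd_at {} v"
  by (simp add: odd_at_def)

lemma odd_at_singleton [simp]: "odd_at {e} v \<longleftrightarrow> v \<in> e"
proof -
  have "{e' \<in> {e}. v \<in> e'} = (if v \<in> e then {e} else {})" by auto
  then show ?thesis by (simp add: odd_at_def)
qed

text \<open>The handshake identity for a graph given by its edge set.\<close>

lemma sum_card_incident:
  assumes "finite V" "finite J" "\<And>e. e \<in> J \<Longrightarrow> e \<subseteq> V \<and> card e = 2"
  shows "(\<Sum>v\<in>V. card {e \<in> J. v \<in> e}) = 2 * card J"
proof -
  have "(\<Sum>v\<in>V. card {e \<in> J. v \<in> e}) = (\<Sum>e\<in>J. card e)"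
  proof (rule sum_multicount_gen[OF assms(1,2)], rule ballI)
    fix e assume "e \<in> J"
    then have "{v \<in> V. v \<in> e} = e" using assms(3) by auto
    then show "card {v \<in> V. v \<in> e} = card e" by simp
  qed
  also have "\<dots> = 2 * card J" using assms(3) by simp
  finally show ?thesis .
qed

text \<open>A path from \<open>u\<close> to \<open>A'\<close>, seen through its degree parities: only \<open>u\<close> has odd degree
  outside \<open>A'\<close>. If the vertices \<open>U\<close> without such a set were nonempty, connectivity would give an
  edge from \<open>U\<close> to a vertex that has one or lies in \<open>A'\<close>, and adding this edge serves its endpoint
  in \<open>U\<close>.\<close>

lemma exists_parity_path:
  assumes "finite H" and edges: "\<And>e. e \<in> H \<Longrightarrow> e \<subseteq> A \<and> card e = 2"
    and "A' \<subseteq> A" "A' \<noteq> {}"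
    and conn: "\<And>S. S \<noteq> {} \<Longrightarrow> S \<subset> A \<Longrightarrow> cut H S \<noteq> {}"
    and "u \<in> A - A'"
  shows "\<exists>K \<subseteq> {e \<in> H. \<not> e \<subseteq> A'}. \<forall>v \<in> A - A'. odd_at K v \<longleftrightarrow> v = u"
proof -
  let ?M = "{e \<in> H. \<not> e \<subseteq> A'}"
  define U where "U = {u \<in> A - A'. \<not> (\<exists>K \<subseteq> ?M. \<forall>v \<in> A - A'. odd_at K v \<longleftrightarrow> v = u)}"
  have "U = {}"
  proof (rule ccontr)
    assume ne: "U \<noteq> {}"
    have "U \<subset> A" using assms(3,4) by (auto simp: U_def)
    then obtain e where e: "e \<in> H" "e \<inter> U \<noteq> {}" "\<not> e \<subseteq> U"
      using conn[OF ne] by (auto simp: cut_def)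
    then obtain a b where ab: "a \<in> e" "a \<in> U" "b \<in> e" "b \<notin> U" by auto
    have e_eq: "e = {a, b}"
      using edges[OF e(1)] ab by (auto simp: card_2_iff)
    have aA: "a \<in> A - A'" using ab(2) by (simp add: U_def)
    have eM: "e \<in> ?M" using e(1) e_eq aA by auto
    have "b \<in> A" using edges[OF e(1)] ab(3) by auto
    have "\<exists>K \<subseteq> ?M. \<forall>v \<in> A - A'. odd_at K v \<longleftrightarrow> v = a"
    proof (cases "b \<in> A'")
      case True
      have "{e} \<subseteq> ?M" using eM by auto
      moreover have "\<forall>v \<in> A - A'. odd_at {e} v \<longleftrightarrow> v = a" using True e_eq by auto
      ultimately show ?thesis by blast
    next
      case False
      then obtain K where K: "K \<subseteq> ?M" "\<forall>v \<in> A - A'. odd_at K v \<longleftrightarrow> v = b"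
        using ab(4) \<open>b \<in> A\<close> unfolding U_def by blast
      have "finite K" using K(1) finite_subset[OF _ assms(1), of K] by blast
      then have "\<forall>v \<in> A - A'. odd_at (sym_diff K {e}) v \<longleftrightarrow> v = a"
        using K(2) e_eq ab by (auto simp only: odd_at_sym_diff finite.intros odd_at_singleton)
      moreover have "sym_diff K {e} \<subseteq> ?M" using K(1) eM by auto
      ultimately show ?thesis by blast
    qed
    then show False using ab(2) unfolding U_def by blast
  qed
  then show ?thesis using assms(6) unfolding U_def by blast
qed

text \<open>A \<open>T\<close>-join in the graph with \<open>A'\<close> contracted. The contracted vertex carries no parity
  condition and absorbs the parity of \<open>T\<close>, so every \<open>T\<close> is possible.\<close>

lemma exists_parity_join:
  assumes "finite A" "finite H" and edges: "\<And>e. e \<in> H \<Longrightarrow> e \<subseteq> A \<and> card e = 2"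
    and "A' \<subseteq> A" "A' \<noteq> {}"
    and conn: "\<And>S. S \<noteq> {} \<Longrightarrow> S \<subset> A \<Longrightarrow> cut H S \<noteq> {}"
    and "T \<subseteq> A - A'"
  shows "\<exists>K \<subseteq> {e \<in> H. \<not> e \<subseteq> A'}. \<forall>v \<in> A - A'. odd_at K v \<longleftrightarrow> v \<in> T"
proof -
  let ?M = "{e \<in> H. \<not> e \<subseteq> A'}"
  have "finite T" using assms(1,7) finite_subset by blast
  then show ?thesis using assms(7)
  proof (induction T rule: finite_induct)
    case empty
    show ?case by (intro exI[of _ "{}"]) auto
  next
    case (insert u T)
    then obtain K where K: "K \<subseteq> ?M" "\<forall>v \<in> A - A'. odd_at K v \<longleftrightarrow> v \<in> T" by auto
    have "u \<in> A - A'" using insert.prems by auto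
    from exists_parity_path[OF assms(2) edges assms(4,5) conn this]
    obtain L where L: "L \<subseteq> ?M" "\<forall>v \<in> A - A'. odd_at L v \<longleftrightarrow> v = u" by blast
    have "finite K" "finite L"
      using K(1) L(1) finite_subset[OF _ assms(2), of K] finite_subset[OF _ assms(2), of L] by blast+
    then have "\<forall>v \<in> A - A'. odd_at (sym_diff K L) v \<longleftrightarrow> v \<in> insert u T"
      using K(2) L(2) insert.hyps(2) by (auto simp only: odd_at_sym_diff)
    moreover have "sym_diff K L \<subseteq> ?M" using K(1) L(1) by blast
    ultimately show ?case by blast
  qed
qed

text \<open>With all cuts of size at least 2 no edge is a bridge. A join in \<open>H - {e}\<close> for the endpoints
  of \<open>e\<close>, closed up by \<open>e\<close>, is the cycle.\<close>

lemma exists_cycle_through_edge: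
  assumes "finite A" "finite H" and edges: "\<And>e. e \<in> H \<Longrightarrow> e \<subseteq> A \<and> card e = 2"
    and "A' \<subseteq> A" "A' \<noteq> {}"
    and cuts: "\<And>S. S \<noteq> {} \<Longrightarrow> S \<subset> A \<Longrightarrow> 2 \<le> card (cut H S)"
    and e: "e \<in> H" "\<not> e \<subseteq> A'"
  shows "\<exists>C \<subseteq> {e \<in> H. \<not> e \<subseteq> A'}. e \<in> C \<and> (\<forall>v \<in> A - A'. \<not> odd_at C v)"
proof -
  have conn: "cut (H - {e}) S \<noteq> {}" if S: "S \<noteq> {}" "S \<subset> A" for S
  proof
    assume "cut (H - {e}) S = {}"
    then have "cut H S \<subseteq> {e}" by (auto simp: cut_def)
    then have "card (cut H S) \<le> 1" using card_mono[of "{e}"] by fastforce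
    then show False using cuts[OF S] by simp
  qed
  have "\<exists>K \<subseteq> {e' \<in> H - {e}. \<not> e' \<subseteq> A'}. \<forall>v \<in> A - A'. odd_at K v \<longleftrightarrow> v \<in> e \<inter> (A - A')"
    by (rule exists_parity_join) (use assms conn in auto)
  then obtain K where K: "K \<subseteq> {e' \<in> H - {e}. \<not> e' \<subseteq> A'}"
    "\<forall>v \<in> A - A'. odd_at K v \<longleftrightarrow> v \<in> e \<inter> (A - A')" by blast
  have "finite K" using K(1) finite_subset[OF _ assms(2), of K] by blast
  then have "\<forall>v \<in> A - A'. \<not> odd_at (sym_diff K {e}) v"
    using K(2) by (auto simp only: odd_at_sym_diff finite.intros odd_at_singleton)
  moreover have "sym_diff K {e} \<subseteq> {e \<in> H. \<not> e \<subseteq> A'}" "e \<in> sym_diff K {e}" using K(1) e by auto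
  ultimately show ?thesis by blast
qed

text \<open>The sums over \<open>D\<close> and over \<open>H\<close> agree modulo 2 for all \<open>t\<close> weights: the parity vector of \<open>H\<close> in
  a \<open>t\<close>-dimensional space over the field with two elements is a sum of at most \<open>t\<close> of the vectors
  of its elements. A smallest \<open>D\<close> works: if it had more than \<open>t\<close> elements, two of its \<open>2 ^ card D\<close>
  subsets would have the same parities by the pigeonhole principle, and their symmetric difference
  could be dropped from \<open>D\<close>.\<close>

lemma exists_small_subset_even_rest:
  fixes w :: "nat \<Rightarrow> 'a \<Rightarrow> int"
  assumes "finite H"
  shows "\<exists>D \<subseteq> H. card D \<le> t \<and> (\<forall>j \<in> {1..t}. even (\<Sum>e \<in> H - D. w j e))"
proof -
  define ok where "ok D \<longleftrightarrow> D \<subseteq> H \<and> (\<forall>j \<in> {1..t}. even (\<Sum>e \<in> H - D. w j e))" for D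
  have "ok H" by (simp add: ok_def)
  then obtain D where okD: "ok D" and min: "\<And>D'. ok D' \<Longrightarrow> card D \<le> card D'"
    using ex_has_least_nat[of ok H card] by blast
  have D: "D \<subseteq> H" "\<And>j. j \<in> {1..t} \<Longrightarrow> even (\<Sum>e \<in> H - D. w j e)"
    using okD unfolding ok_def by blast+
  have finD: "finite D" using D(1) assms by (rule finite_subset)
  have "card D \<le> t"
  proof (rule ccontr)
    assume "\<not> card D \<le> t"
    define par where "par = (\<lambda>Z. {j \<in> {1..t}. odd (\<Sum>e\<in>Z. w j e)})"
    have "card (par ` Pow D) \<le> card (Pow {1..t})"
      by (rule card_mono) (auto simp: par_def)
    also have "\<dots> < card (Pow D)"
      using \<open>\<not> card D \<le> t\<close> finD by (simp add: card_Pow)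
    finally have "\<not> inj_on par (Pow D)" by (rule pigeonhole)
    then obtain X Y where XY: "X \<subseteq> D" "Y \<subseteq> D" "X \<noteq> Y" "par X = par Y"
      unfolding inj_on_def by blast
    let ?Z = "sym_diff X Y"
    have fin: "finite X" "finite Y" using finite_subset[OF XY(1) finD] finite_subset[OF XY(2) finD] by simp_all
    have evenZ: "even (\<Sum>e\<in>?Z. w j e)" if j: "j \<in> {1..t}" for j
    proof -
      have "(\<Sum>e\<in>?Z. w j e) = (\<Sum>e\<in>X - Y. w j e) + (\<Sum>e\<in>Y - X. w j e)"
        by (rule sum.union_disjoint) (use fin in auto)
      moreover have "(\<Sum>e\<in>X. w j e) = (\<Sum>e\<in>X - Y. w j e) + (\<Sum>e\<in>X \<inter> Y. w j e)"
        using sum.Int_Diff[OF fin(1), of "w j" Y] by simp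
      moreover have "(\<Sum>e\<in>Y. w j e) = (\<Sum>e\<in>Y - X. w j e) + (\<Sum>e\<in>X \<inter> Y. w j e)"
        using sum.Int_Diff[OF fin(2), of "w j" X] by (simp add: Int_commute)
      moreover have "odd (\<Sum>e\<in>X. w j e) \<longleftrightarrow> odd (\<Sum>e\<in>Y. w j e)"
        using XY(4) j unfolding par_def by blast
      ultimately show ?thesis by presburger
    qed
    have "even (\<Sum>e \<in> H - (D - ?Z). w j e)" if j: "j \<in> {1..t}" for j
    proof -
      have "H - (D - ?Z) = (H - D) \<union> ?Z" using XY(1,2) D(1) by auto
      moreover have "(\<Sum>e \<in> (H - D) \<union> ?Z. w j e) = (\<Sum>e \<in> H - D. w j e) + (\<Sum>e\<in>?Z. w j e)"
        by (rule sum.union_disjoint) (use fin assms XY(1,2) in auto)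
      ultimately show ?thesis using evenZ[OF j] D(2)[OF j] by simp
    qed
    then have "ok (D - ?Z)" using D(1) unfolding ok_def by blast
    from min[OF this] have "card D \<le> card (D - ?Z)" .
    moreover have "D - ?Z \<subset> D" using XY(1-3) by blast
    then have "card (D - ?Z) < card D" by (rule psubset_card_mono[OF finD])
    ultimately show False by linarith
  qed
  with D show ?thesis by blast
qed

section \<open>Half-integral points\<close>

locale tseitin_instance =
  fixes V :: "'v set" and E :: "'v set set" and idx :: "'v set \<Rightarrow> 'n::finite"
  assumes graph: "simple_graph V E"
    and idx: "bij_betw idx E (UNIV :: 'n set)"
begin

abbreviation P where "P \<equiv> tseitin_polytope V E idx"

text \<open>Membership in \<open>H\<close> takes precedence over membership in \<open>J\<close>, so the two sets may overlap.\<close>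

definition half_point :: "'v set set \<Rightarrow> 'v set set \<Rightarrow> real ^ 'n" where
  "half_point H J = (\<chi> i. let e = inv_into E idx i in
     if e \<in> H then 1/2 else if e \<in> J then 1 else 0)"

lemma finite_V: "finite V" and edge: "e \<in> E \<Longrightarrow> e \<subseteq> V" "e \<in> E \<Longrightarrow> card e = 2"
  using graph by (auto simp: simple_graph_def)

lemma finite_E: "finite E"
  using finite_V edge(1) by (meson PowI finite_Pow_iff finite_subset subsetI)

lemma half_point_idx:
  "e \<in> E \<Longrightarrow> half_point H J $ idx e = (if e \<in> H then 1/2 else if e \<in> J then 1 else 0)"
  using idx by (simp add: half_point_def bij_betw_def)

lemma vec_eqI:
  fixes x y :: "real ^ 'n"
  assumes "\<And>e. e \<in> E \<Longrightarrow> x $ idx e = y $ idx e"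
  shows "x = y"
proof -
  have "x $ i = y $ i" for i
  proof -
    obtain e where "e \<in> E" "i = idx e" using idx unfolding bij_betw_def by blast
    then show ?thesis using assms by simp
  qed
  then show ?thesis by (simp add: vec_eq_iff)
qed

lemma inner_edges:
  fixes x y :: "real ^ 'n"
  shows "x \<bullet> y = (\<Sum>e\<in>E. x $ idx e * y $ idx e)"
  using sum.reindex_bij_betw[OF idx, of "\<lambda>i. x $ i * y $ i"] by (simp add: inner_vec_def)

lemma nbrs_bij:
  assumes "u \<in> V"
  shows "bij_betw (\<lambda>v. {u, v}) (nbrs V E u) {e \<in> E. u \<in> e}"
  unfolding bij_betw_def
proof
  show "inj_on (\<lambda>v. {u, v}) (nbrs V E u)"
    by (auto simp: inj_on_def doubleton_eq_iff)
  show "(\<lambda>v. {u, v}) ` nbrs V E u = {e \<in> E. u \<in> e}"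
  proof (intro equalityI subsetI)
    fix e assume "e \<in> {e \<in> E. u \<in> e}"
    then have e: "e \<in> E" "u \<in> e" by auto
    then obtain v where "e = {u, v}" using edge(2)[OF e(1)] by (auto simp: card_2_iff)
    moreover then have "v \<in> V" using edge(1)[OF e(1)] by auto
    ultimately show "e \<in> (\<lambda>v. {u, v}) ` nbrs V E u" using e by (auto simp: nbrs_def)
  qed (auto simp: nbrs_def)
qed

lemma card_nbrs_filter:
  assumes "u \<in> V"
  shows "card {v \<in> nbrs V E u. Q {u, v}} = card {e \<in> E. u \<in> e \<and> Q e}"
proof (rule bij_betw_same_card)
  have "(\<lambda>v. {u, v}) ` {v \<in> nbrs V E u. Q {u, v}} = {e \<in> (\<lambda>v. {u, v}) ` nbrs V E u. Q e}"
    by auto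
  also have "\<dots> = {e \<in> E. u \<in> e \<and> Q e}"
    using nbrs_bij[OF assms] by (auto simp: bij_betw_def)
  finally have "(\<lambda>v. {u, v}) ` {v \<in> nbrs V E u. Q {u, v}} = {e \<in> E. u \<in> e \<and> Q e}" .
  then show "bij_betw (\<lambda>v. {u, v}) {v \<in> nbrs V E u. Q {u, v}} {e \<in> E. u \<in> e \<and> Q e}"
    using bij_betw_subset[OF nbrs_bij[OF assms], of "{v \<in> nbrs V E u. Q {u, v}}"] by auto
qed

lemma finite_nbrs: "finite (nbrs V E u)"
  using finite_V by (simp add: nbrs_def)

lemma tseitin_sum_eq:
  fixes x :: "real ^ 'n"
  assumes "F \<subseteq> nbrs V E u"
  shows "(\<Sum>v \<in> nbrs V E u - F. x $ idx {u, v}) + (\<Sum>v\<in>F. 1 - x $ idx {u, v}) =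
    (\<Sum>v \<in> nbrs V E u. if v \<in> F then 1 - x $ idx {u, v} else x $ idx {u, v})"
  by (subst sum.subset_diff[OF assms finite_nbrs]) (auto intro!: arg_cong2[of _ _ _ _ "(+)"] sum.cong)

text \<open>The inequality at \<open>u\<close> for \<open>F\<close> compares \<open>x\<close> with the pattern \<open>F\<close> on the edges at \<open>u\<close> and asks
  for total deviation at least 1. Two half edges contribute 1/2 each, whatever \<open>F\<close> is; without
  half edges, \<open>x\<close> has an odd pattern and differs from the even set \<open>F\<close> in some entry by 1.\<close>

lemma half_point_in_P:
  assumes "\<And>u. u \<in> V \<Longrightarrow> 2 \<le> card {e \<in> H. u \<in> e} \<or> ({e \<in> H. u \<in> e} = {} \<and> odd_at J u)"
    and "H \<subseteq> E" "J \<subseteq> E"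
  shows "half_point H J \<in> P"
  unfolding tseitin_polytope_def
proof (intro CollectI conjI ballI allI impI)
  fix u F assume u: "u \<in> V" and F: "F \<subseteq> nbrs V E u \<and> even (card F)"
  let ?N = "nbrs V E u" and ?x = "half_point H J"
  let ?g = "\<lambda>v. if v \<in> F then 1 - ?x $ idx {u, v} else ?x $ idx {u, v}"
  have inE: "{u, v} \<in> E" if "v \<in> ?N" for v using that by (simp add: nbrs_def)
  have nonneg: "0 \<le> ?g v" if "v \<in> ?N" for v
    using inE[OF that] by (auto simp: half_point_idx)
  have "1 \<le> (\<Sum>v\<in>?N. ?g v)"
  proof (cases "2 \<le> card {e \<in> H. u \<in> e}")
    case True
    \<comment> \<open>Half edges deviate by 1/2 whether or not they belong to \<open>F\<close>.\<close>
    let ?N2 = "{v \<in> ?N. {u, v} \<in> H}"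
    have "{e \<in> H. u \<in> e} = {e \<in> E. u \<in> e \<and> e \<in> H}" using assms(2) by auto
    then have "2 \<le> card ?N2" using True card_nbrs_filter[OF u, of "\<lambda>e. e \<in> H"] by simp
    then have "1 \<le> (\<Sum>v\<in>?N2. 1/2 :: real)" by simp
    also have "\<dots> = (\<Sum>v\<in>?N2. ?g v)"
      by (rule sum.cong) (auto simp: half_point_idx inE)
    also have "\<dots> \<le> (\<Sum>v\<in>?N. ?g v)"
      by (rule sum_mono2) (use finite_nbrs nonneg in auto)
    finally show ?thesis .
  next
    case False
    then have noH: "{e \<in> H. u \<in> e} = {}" and par: "odd_at J u" using assms(1)[OF u] by auto
    have xv: "?x $ idx {u, v} = (if {u, v} \<in> J then 1 else 0)" if "v \<in> ?N" for v
      using noH inE[OF that] by (auto simp: half_point_idx)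
    have "{e \<in> J. u \<in> e} = {e \<in> E. u \<in> e \<and> e \<in> J}" using assms(3) by auto
    then have "odd (card {v \<in> ?N. {u, v} \<in> J})"
      using par card_nbrs_filter[OF u, of "\<lambda>e. e \<in> J"] by (simp add: odd_at_def)
    then have "F \<noteq> {v \<in> ?N. {u, v} \<in> J}" using F by auto
    then obtain v where v: "v \<in> ?N" "v \<in> F \<longleftrightarrow> {u, v} \<notin> J" using F by blast
    then have "1 = ?g v" using xv[OF v(1)] by auto
    also have "\<dots> \<le> (\<Sum>v\<in>?N. ?g v)"
      by (rule member_le_sum) (use v finite_nbrs nonneg in auto)
    finally show ?thesis .
  qed
  then show "1 \<le> (\<Sum>v \<in> ?N - F. ?x $ idx {u, v}) + (\<Sum>v\<in>F. 1 - ?x $ idx {u, v})"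
    using tseitin_sum_eq[of F u ?x] F by simp
qed (auto simp: half_point_idx)

text \<open>The inequality whose \<open>F\<close> is the set of ones of an integral point at \<open>u\<close> would read \<open>0 \<ge> 1\<close>, so
  this set is odd at every \<open>u\<close>. An odd number of odd degrees contradicts the handshake identity.\<close>

lemma integer_hull_empty:
  assumes "odd (card V)"
  shows "integer_hull P = {}"
proof -
  have False if x: "x \<in> P" "integral_vec x" for x
  proof -
    let ?J = "{e \<in> E. x $ idx e = 1}"
    have x01: "x $ idx e = 0 \<or> x $ idx e = 1" if "e \<in> E" for e
    proof -
      have b: "0 \<le> x $ idx e" "x $ idx e \<le> 1"
        using x(1) that by (auto simp: tseitin_polytope_def)
      obtain k where "x $ idx e = of_int k"
        using x(2) by (auto simp: integral_vec_def elim: Ints_cases)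
      then show ?thesis using b by auto
    qed
    have "odd (card {e \<in> ?J. u \<in> e})" if u: "u \<in> V" for u
    proof
      assume ev: "even (card {e \<in> ?J. u \<in> e})"
      have ineq: "1 \<le> (\<Sum>v \<in> nbrs V E u - F. x $ idx {u, v}) + (\<Sum>v\<in>F. 1 - x $ idx {u, v})"
        if "F \<subseteq> nbrs V E u" "even (card F)" for F
        using x(1) u that unfolding tseitin_polytope_def by blast
      let ?F = "{v \<in> nbrs V E u. x $ idx {u, v} = 1}"
      have "{e \<in> ?J. u \<in> e} = {e \<in> E. u \<in> e \<and> x $ idx e = 1}" by auto
      then have "even (card ?F)"
        using ev card_nbrs_filter[OF u, of "\<lambda>e. x $ idx e = 1"] by simp
      then have "1 \<le> (\<Sum>v \<in> nbrs V E u - ?F. x $ idx {u, v}) + (\<Sum>v\<in>?F. 1 - x $ idx {u, v})"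
        by (intro ineq) auto
      also have "\<dots> = 0"
      proof -
        have "x $ idx {u, v} = 0" if "v \<in> nbrs V E u - ?F" for v
          using x01[of "{u, v}"] that by (auto simp: nbrs_def)
        then have "(\<Sum>v \<in> nbrs V E u - ?F. x $ idx {u, v}) = 0" by (rule sum.neutral[OF ballI])
        moreover have "(\<Sum>v\<in>?F. 1 - x $ idx {u, v}) = 0" by simp
        ultimately show ?thesis by linarith
      qed
      finally show False by simp
    qed
    then have "odd (\<Sum>v\<in>V. card {e \<in> ?J. v \<in> e})"
      using assms finite_V by (simp add: even_sum_iff cong: conj_cong)
    moreover have "(\<Sum>v\<in>V. card {e \<in> ?J. v \<in> e}) = 2 * card ?J"
      by (rule sum_card_incident) (use finite_V finite_E edge in auto)
    ultimately show False by simp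
  qed
  then have "{x \<in> P. integral_vec x} = {}" by blast
  then show ?thesis unfolding integer_hull_def by (simp only: convex_hull_empty)
qed

lemma half_point_split:
  assumes "D \<subseteq> H"
  shows "half_point H J =
    (1/2) *\<^sub>R half_point (H - D) (J \<union> D) + (1/2) *\<^sub>R half_point (H - D) (J - D)"
  by (rule vec_eqI) (use assms in \<open>auto simp: half_point_idx\<close>)

text \<open>Half edges contribute half of their total weight, all other edges an integer.\<close>

lemma inner_half_point_Ints:
  assumes "H \<subseteq> E" and w: "\<And>e. e \<in> E \<Longrightarrow> p $ idx e = of_int (w e)"
    and ev: "even (\<Sum>e\<in>H. w e)"
  shows "p \<bullet> half_point H J \<in> \<int>"
proof -
  have "p \<bullet> half_point H J = (\<Sum>e\<in>H. p $ idx e * half_point H J $ idx e) +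
      (\<Sum>e\<in>E - H. p $ idx e * half_point H J $ idx e)"
    unfolding inner_edges by (subst sum.subset_diff[OF assms(1) finite_E]) simp
  also have "(\<Sum>e\<in>H. p $ idx e * half_point H J $ idx e) = (\<Sum>e\<in>H. of_int (w e) / 2)"
    by (rule sum.cong) (use assms(1) w in \<open>auto simp: half_point_idx\<close>)
  also have "\<dots> = of_int (\<Sum>e\<in>H. w e) / 2" by (simp add: sum_divide_distrib)
  also have "\<dots> = of_int ((\<Sum>e\<in>H. w e) div 2)"
  proof -
    obtain m where "(\<Sum>e\<in>H. w e) = 2 * m" using ev by (rule evenE)
    then show ?thesis by (simp del: of_int_sum)
  qed
  finally have "p \<bullet> half_point H J = of_int ((\<Sum>e\<in>H. w e) div 2) +
      (\<Sum>e\<in>E - H. p $ idx e * half_point H J $ idx e)" .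
  moreover have "(\<Sum>e\<in>E - H. p $ idx e * half_point H J $ idx e) \<in> \<int>"
    by (rule Ints_sum) (auto simp: half_point_idx w)
  ultimately show ?thesis by simp
qed


text \<open>The index type is nonempty, so the graph has an edge.\<close>

lemma card_V_ge_2: "2 \<le> card V"
proof -
  obtain e where "e \<in> E" using idx by (auto simp: bij_betw_def)
  then show ?thesis using edge[of e] card_mono[OF finite_V, of e] by simp
qed

lemma cut_compl:
  assumes "S \<subseteq> V"
  shows "cut E (V - S) = cut E S"
proof -
  have "e \<inter> (V - S) \<noteq> {} \<and> \<not> e \<subseteq> V - S \<longleftrightarrow> e \<inter> S \<noteq> {} \<and> \<not> e \<subseteq> S" if "e \<in> E" for e
    using edge(1)[OF that] by blast
  then show ?thesis by (auto simp: cut_def)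
qed

text \<open>For a partition into three parts, an edge running between two of them lies in exactly two of the
  three cuts. Hence the edges between different parts form the disjoint union of \<open>cut E B\<close> and
  \<open>cut E S \<inter> cut E T\<close>, and both cuts of \<open>S\<close> and \<open>T\<close> lie in this union.\<close>

lemma three_cuts_le:
  assumes "V = B \<union> S \<union> T" and disj: "B \<inter> S = {}" "B \<inter> T = {}" "S \<inter> T = {}"
    and "finite Q" and Q: "cut E B \<subseteq> Q" "cut E S \<inter> cut E T \<subseteq> Q"
  shows "card (cut E B) + card (cut E S) + card (cut E T) \<le> 2 * card Q"
proof -
  have fin: "finite (cut E X)" for X using finite_E by (simp add: cut_def)
  have no_triple: "e \<notin> cut E B" if e: "e \<in> cut E S \<inter> cut E T" for e
  proof
    assume "e \<in> cut E B"
    then obtain a b d where "a \<in> e" "a \<in> B" "b \<in> e" "b \<in> S" "d \<in> e" "d \<in> T"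
      using e by (auto simp: cut_def)
    moreover from this have "a \<noteq> b" "a \<noteq> d" "b \<noteq> d" using disj by blast+
    ultimately have "{a, b, d} \<subseteq> e" "card {a, b, d} = 3" by auto
    moreover have "card e = 2" "finite e"
      using e edge(2)[of e] card.infinite by (auto simp: cut_def)
    ultimately show False using card_mono[of e "{a, b, d}"] by simp
  qed
  have "cut E S \<union> cut E T \<subseteq> cut E B \<union> (cut E S \<inter> cut E T)"
  proof
    fix e assume "e \<in> cut E S \<union> cut E T"
    moreover then have "e \<subseteq> V" using edge(1) by (auto simp: cut_def)
    ultimately show "e \<in> cut E B \<union> (cut E S \<inter> cut E T)"
      using assms(1) disj by (auto simp: cut_def)
  qed
  then have "card (cut E S \<union> cut E T) \<le> card Q"
    using Q by (intro card_mono assms(5)) auto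
  moreover have "card (cut E B \<union> (cut E S \<inter> cut E T)) \<le> card Q"
    using Q by (intro card_mono assms(5)) auto
  moreover have "card (cut E B \<union> (cut E S \<inter> cut E T)) = card (cut E B) + card (cut E S \<inter> cut E T)"
    by (rule card_Un_disjoint) (use fin no_triple in auto)
  ultimately show ?thesis
    using card_Un_Int[OF fin fin, of S T] by linarith
qed

end

section \<open>Surviving the closure rounds\<close>

locale expanding_tseitin = tseitin_instance V E idx
  for V :: "'v set" and E :: "'v set set" and idx :: "'v set \<Rightarrow> 'n::finite" +
  fixes t :: nat and c :: real
  assumes t_pos: "1 \<le> t" and odd_V: "odd (card V)" and c_gt: "real t + 1 < c"
    and expansion: "\<lbrakk>S \<subseteq> V; S \<noteq> {}; 2 * card S \<le> card V\<rbrakk> \<Longrightarrow>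
      c * real (card S) \<le> real (card (cut E S))"
begin

text \<open>The total number of edges rounded in the rounds has to stay below this number.\<close>

definition budget :: real where
  "budget = (c - (real t + 1)) / 2 * real (card V)"

text \<open>The edges at \<open>A\<close> that have been spent: those leaving \<open>A\<close> and those inside \<open>A\<close> that are not
  half edges.\<close>

definition lost_edges :: "'v set \<Rightarrow> 'v set set \<Rightarrow> 'v set set" where
  "lost_edges A H = {e \<in> E. e \<inter> A \<noteq> {}} - {e \<in> H. e \<subseteq> A}"

text \<open>The invariant of the vertex set \<open>A\<close> on which the point is still half-integral. Its third conjunct is
  the account: the lost edges at \<open>A\<close> are paid for by the \<open>f\<close> edges rounded in the rounds and by
  \<open>t + 1\<close> edges for every vertex outside \<open>A\<close>. This records the past rounds only by its
  outcome, so no list of the earlier splits has to be carried along.\<close>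

definition core :: "nat \<Rightarrow> nat \<Rightarrow> 'v set \<Rightarrow> 'v set set \<Rightarrow> bool" where
  "core r f A H \<longleftrightarrow> A \<subseteq> V \<and> card V < 2 * card A \<and>
     card (lost_edges A H) \<le> f + (t + 1) * card (V - A) \<and>
     (\<forall>S. S \<noteq> {} \<and> S \<subset> A \<longrightarrow> r \<le> card (cut {e \<in> H. e \<subseteq> A} S))"

text \<open>The point \<open>half_point H J\<close> in this situation: the half edges lie inside \<open>A\<close>, and the parity
  conditions outside \<open>A\<close> are settled.\<close>

definition state :: "nat \<Rightarrow> nat \<Rightarrow> 'v set \<Rightarrow> 'v set set \<Rightarrow> 'v set set \<Rightarrow> bool" where
  "state r f A H J \<longleftrightarrow> core r f A H \<and> H \<subseteq> E \<and> J \<subseteq> E \<and> (\<forall>e\<in>H. e \<subseteq> A) \<and>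
     (\<forall>v\<in>V - A. odd_at J v)"

lemma finite_lost_edges: "finite (lost_edges A H)"
  using finite_E by (simp add: lost_edges_def)

text \<open>A smallest set \<open>B \<subseteq> A\<close> that still satisfies the account and contains more than half of the vertices
  has no cut \<open>(S, B - S)\<close> with at most \<open>t + 1\<close> half edges. If one side had more than half of the
  vertices, the other could be split off: the allowance grows by at least \<open>t + 1\<close>, enough to pay for
  the cut (\<open>shrink\<close> below). Otherwise \<open>V - B\<close>, \<open>S\<close> and \<open>B - S\<close> all have at most half of the
  vertices, and expansion of the three sets requires \<open>c |V| / 2\<close> edges between them, more than
  have been lost.\<close>

lemma exists_core:
  assumes start: "core r f A H" and "H \<subseteq> E" and f: "real f + real t < budget"
  shows "\<exists>A' \<subseteq> A. core (t + 2) f A' H"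
proof -
  define ok where "ok B \<longleftrightarrow> B \<subseteq> A \<and> card V < 2 * card B \<and>
    card (lost_edges B H) \<le> f + (t + 1) * card (V - B)" for B
  have "ok A" using start by (auto simp: ok_def core_def)
  then obtain B where okB: "ok B" and least: "\<And>B'. ok B' \<Longrightarrow> card B \<le> card B'"
    using ex_has_least_nat[of ok A card] by blast
  have BV: "B \<subseteq> V" using okB start by (auto simp: ok_def core_def)
  then have finB: "finite B" using finite_V finite_subset by blast
  have bound: "card (lost_edges B H) \<le> f + (t + 1) * card (V - B)" using okB by (simp add: ok_def)
  let ?n = "real (card V)"
  have shrink: False
    if part: "S \<union> T = B" "S \<inter> T = {}" "S \<noteq> {}"
      and few: "card (cut {e \<in> H. e \<subseteq> B} S) \<le> t + 1" and big: "card V < 2 * card T" for S T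
  proof -
    have finS: "finite S" "finite T" using finB part(1) by auto
    have "lost_edges T H \<subseteq> lost_edges B H \<union> cut {e \<in> H. e \<subseteq> B} S"
      using part by (auto simp: lost_edges_def cut_def)
    then have "card (lost_edges T H) \<le> card (lost_edges B H \<union> cut {e \<in> H. e \<subseteq> B} S)"
      using finite_E \<open>H \<subseteq> E\<close> by (intro card_mono) (auto simp: cut_def finite_lost_edges finite_subset)
    also have "\<dots> \<le> card (lost_edges B H) + card (cut {e \<in> H. e \<subseteq> B} S)"
      by (rule card_Un_le)
    also have "\<dots> \<le> f + (t + 1) * (card (V - B) + 1)"
      using bound few by (simp add: algebra_simps)
    also have "\<dots> \<le> f + (t + 1) * card (V - T)"
    proof -
      have "V - T = (V - B) \<union> S" using part BV by auto
      moreover have "card ((V - B) \<union> S) = card (V - B) + card S"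
        by (rule card_Un_disjoint) (use finite_V finS part in auto)
      moreover have "1 \<le> card S" using part(3) finS by (simp add: Suc_le_eq card_gt_0_iff)
      ultimately have "card (V - B) + 1 \<le> card (V - T)" by simp
      then show ?thesis by (intro add_left_mono mult_left_mono) auto
    qed
    finally have "ok T" using big part(1) okB by (auto simp: ok_def)
    then have "card B \<le> card T" by (rule least)
    moreover have "T \<subset> B" using part by auto
    then have "card T < card B" by (rule psubset_card_mono[OF finB])
    ultimately show False by simp
  qed
  have "t + 2 \<le> card (cut {e \<in> H. e \<subseteq> B} S)" if S: "S \<noteq> {}" "S \<subset> B" for S
  proof (rule ccontr)
    let ?H = "{e \<in> H. e \<subseteq> B}"
    let ?T = "B - S"
    assume "\<not> ?thesis"
    then have few: "card (cut ?H S) \<le> t + 1" by simp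
    have cutT: "cut ?H ?T = cut ?H S" using S by (auto simp: cut_def)
    have smallT: "2 * card ?T \<le> card V" using shrink[of S ?T] S few by fastforce
    have smallS: "2 * card S \<le> card V" using shrink[of ?T S] S few cutT by fastforce
    \<comment> \<open>Since \<open>B\<close> has more than half of the vertices, \<open>2 |V - B| + 2\<close> below is at most \<open>|V| + 1\<close>.\<close>
    have smallB: "2 * card (V - B) + 1 \<le> card V"
    proof -
      have "card V = card B + card (V - B)"
        using card_Int_Diff[OF finite_V, of B] BV by (simp add: Int_absorb1)
      then show ?thesis using okB by (simp add: ok_def)
    qed
    have sizes: "card V = card (V - B) + card S + card ?T"
    proof -
      have "card V = card B + card (V - B)"
        using card_Int_Diff[OF finite_V, of B] BV by (simp add: Int_absorb1)
      moreover have "card B = card S + card ?T"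
        using card_Int_Diff[OF finB, of S] S by (simp add: Int_absorb1)
      ultimately show ?thesis by simp
    qed
    have exp: "c * real (card X) \<le> real (card (cut E X))" if "X \<subseteq> V" "2 * card X \<le> card V" for X
      using expansion[of X] that by (cases "X = {}") auto
    let ?Q = "lost_edges B H \<union> cut ?H S"
    have three: "card (cut E (V - B)) + card (cut E S) + card (cut E ?T) \<le> 2 * card ?Q"
    proof (rule three_cuts_le)
      show "finite ?Q"
        using finite_E \<open>H \<subseteq> E\<close> by (auto simp: cut_def finite_lost_edges finite_subset)
      show "cut E (V - B) \<subseteq> ?Q"
        unfolding cut_compl[OF BV] by (auto simp: cut_def lost_edges_def)
      show "cut E S \<inter> cut E ?T \<subseteq> ?Q"
        by (auto simp: cut_def lost_edges_def)
    qed (use S BV in auto)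
    have "card ?Q \<le> card (lost_edges B H) + card (cut ?H S)" by (rule card_Un_le)
    then have Q: "card ?Q \<le> f + (t + 1) * (card (V - B) + 1)"
      using bound few by (simp add: algebra_simps)
    have "c * ?n = c * real (card (V - B)) + c * real (card S) + c * real (card ?T)"
      by (simp add: sizes algebra_simps)
    also have "\<dots> \<le> real (card (cut E (V - B)) + card (cut E S) + card (cut E ?T))"
      using exp[of "V - B"] exp[of S] exp[of ?T] smallB smallS smallT S BV by fastforce
    also have "\<dots> \<le> real (2 * card ?Q)" using three by (simp only: of_nat_le_iff)
    also have "\<dots> \<le> real (2 * (f + (t + 1) * (card (V - B) + 1)))"
      using Q by (intro of_nat_mono mult_le_mono2)
    also have "\<dots> = 2 * real f + (real t + 1) * real (2 * card (V - B) + 2)"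
      by (simp add: algebra_simps)
    also have "\<dots> \<le> 2 * real f + (real t + 1) * (?n + 1)"
    proof -
      have "real (2 * card (V - B) + 2) \<le> ?n + 1"
        using smallB by linarith
      then show ?thesis by (intro add_left_mono mult_left_mono) auto
    qed
    finally have "(c - (real t + 1)) * ?n \<le> 2 * real f + (real t + 1)"
      by (simp add: algebra_simps)
    \<comment> \<open>The surplus \<open>t + 1\<close> is covered by the slack of \<open>t\<close> in the hypothesis, as \<open>t + 1 \<le> 2 t\<close>.\<close>
    moreover have "2 * (real f + real t) < (c - (real t + 1)) * ?n"
      using f by (simp add: budget_def)
    ultimately show False using t_pos by simp
  qed
  then have "core (t + 2) f B H"
    using okB BV by (auto simp: core_def ok_def)
  then show ?thesis using okB by (auto simp: ok_def)
qed

lemma state_cut: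
  assumes "state r f A H J" "S \<noteq> {}" "S \<subset> A"
  shows "r \<le> card (cut H S)"
proof -
  have "{e \<in> H. e \<subseteq> A} = H" using assms(1) by (auto simp: state_def)
  then show ?thesis using assms by (auto simp: state_def core_def)
qed

lemma state_in_P:
  assumes "state 2 f A H J"
  shows "half_point H J \<in> P"
proof (rule half_point_in_P)
  show "H \<subseteq> E" "J \<subseteq> E" using assms by (auto simp: state_def)
  fix u assume "u \<in> V"
  show "2 \<le> card {e \<in> H. u \<in> e} \<or> {e \<in> H. u \<in> e} = {} \<and> odd_at J u"
  proof (cases "u \<in> A")
    case True
    have "card A \<noteq> 1" using assms card_V_ge_2 by (auto simp: state_def core_def)
    then have "{u} \<subset> A" using True by (auto simp: card_1_singleton_iff)
    then have "2 \<le> card (cut H {u})" by (intro state_cut[OF assms]) auto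
    moreover have "cut H {u} \<subseteq> {e \<in> H. u \<in> e}" by (auto simp: cut_def)
    moreover have "finite {e \<in> H. u \<in> e}"
      using \<open>H \<subseteq> E\<close> finite_E finite_subset by fastforce
    ultimately have "2 \<le> card {e \<in> H. u \<in> e}" using card_mono le_trans by blast
    then show ?thesis ..
  next
    case False
    then show ?thesis using assms \<open>u \<in> V\<close> by (auto simp: state_def)
  qed
qed

text \<open>The half edges \<open>M\<close> not inside \<open>A'\<close> are rounded to 1 on \<open>K\<close> and to 0 on \<open>M - K\<close>, where \<open>K\<close> ranges over
  the set \<open>Sol\<close> of all choices that make the degrees of ones odd on \<open>A - A'\<close>. Adding a cycle through
  \<open>e\<close> modulo 2 pairs the choices containing \<open>e\<close> with those avoiding it, so the uniform average over
  \<open>Sol\<close> is 1/2 on each edge of \<open>M\<close>.\<close>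

lemma state_in_hull_of_core_states:
  assumes st: "state 2 f A H J" and "A' \<subseteq> A" and core: "core (t + 2) f A' H"
  shows "half_point H J \<in> convex hull {half_point H' J' | H' J'. state (t + 2) f A' H' J'}"
proof -
  define M where "M = {e \<in> H. \<not> e \<subseteq> A'}"
  define H' where "H' = {e \<in> H. e \<subseteq> A'}"
  have HE: "H \<subseteq> E" and JE: "J \<subseteq> E" and HA: "\<And>e. e \<in> H \<Longrightarrow> e \<subseteq> A" and AV: "A \<subseteq> V"
    using st by (auto simp: state_def core_def)
  have finH: "finite H" using HE finite_E by (rule finite_subset)
  have finA: "finite A" using AV finite_V by (rule finite_subset)
  have finM: "finite M" using finH by (simp add: M_def)
  have finJ: "finite J" using JE finite_E by (rule finite_subset)
  have "A' \<noteq> {}" using core by (auto simp: core_def)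
  have edgesH: "e \<subseteq> A \<and> card e = 2" if "e \<in> H" for e using that HA HE edge(2) by auto
  have cuts: "2 \<le> card (cut H S)" if "S \<noteq> {}" "S \<subset> A" for S using state_cut[OF st that] .
  \<comment> \<open>The vertices whose parity \<open>K\<close> has to correct.\<close>
  define T where "T = {v \<in> A - A'. \<not> odd_at (J - M) v}"
  define Sol where "Sol = {K. K \<subseteq> M \<and> (\<forall>v \<in> A - A'. odd_at K v \<longleftrightarrow> v \<in> T)}"
  have finSol: "finite Sol"
    using finM by (rule finite_subset[rotated, OF finite_Pow_iff[THEN iffD2]]) (auto simp: Sol_def)
  have "\<exists>K \<subseteq> {e \<in> H. \<not> e \<subseteq> A'}. \<forall>v \<in> A - A'. odd_at K v \<longleftrightarrow> v \<in> T"
  proof (rule exists_parity_join[OF finA finH edgesH \<open>A' \<subseteq> A\<close> \<open>A' \<noteq> {}\<close>])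
    show "cut H S \<noteq> {}" if "S \<noteq> {}" "S \<subset> A" for S
    proof
      assume "cut H S = {}"
      then show False using cuts[OF that] by simp
    qed
    show "T \<subseteq> A - A'" by (auto simp: T_def)
  qed
  then have "Sol \<noteq> {}" by (auto simp: Sol_def M_def)
  have half: "2 * card {K \<in> Sol. e \<in> K} = card Sol" if e: "e \<in> M" for e
  proof -
    have "\<exists>C \<subseteq> {e \<in> H. \<not> e \<subseteq> A'}. e \<in> C \<and> (\<forall>v \<in> A - A'. \<not> odd_at C v)"
      by (rule exists_cycle_through_edge[OF finA finH edgesH \<open>A' \<subseteq> A\<close> \<open>A' \<noteq> {}\<close> cuts])
        (use e in \<open>auto simp: M_def\<close>)
    then obtain C where C: "C \<subseteq> M" "e \<in> C" "\<forall>v \<in> A - A'. \<not> odd_at C v"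
      unfolding M_def by blast
    have finC: "finite C" using C(1) finM by (rule finite_subset)
    have flip: "sym_diff K C \<in> Sol" if "K \<in> Sol" for K
    proof -
      have K: "K \<subseteq> M" "\<forall>v \<in> A - A'. odd_at K v \<longleftrightarrow> v \<in> T" using that by (auto simp: Sol_def)
      have "finite K" using K(1) finM by (rule finite_subset)
      then have "\<forall>v \<in> A - A'. odd_at (sym_diff K C) v \<longleftrightarrow> v \<in> T"
        using K(2) C(3) finC by (simp only: odd_at_sym_diff) blast
      then show ?thesis using K(1) C(1) unfolding Sol_def by blast
    qed
    have "bij_betw (\<lambda>K. sym_diff K C) {K \<in> Sol. e \<in> K} {K \<in> Sol. e \<notin> K}"
    proof (rule bij_betwI[where g = "\<lambda>K. sym_diff K C"])
      show "(\<lambda>K. sym_diff K C) \<in> {K \<in> Sol. e \<in> K} \<rightarrow> {K \<in> Sol. e \<notin> K}"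
        using flip C(2) by blast
      show "(\<lambda>K. sym_diff K C) \<in> {K \<in> Sol. e \<notin> K} \<rightarrow> {K \<in> Sol. e \<in> K}"
        using flip C(2) by blast
    qed auto
    then have "card {K \<in> Sol. e \<in> K} = card {K \<in> Sol. e \<notin> K}" by (rule bij_betw_same_card)
    moreover have "card Sol = card {K \<in> Sol. e \<in> K} + card {K \<in> Sol. e \<notin> K}"
      using card_Int_Diff[OF finSol, of "{K. e \<in> K}"]
      by (simp add: Int_def set_diff_eq)
    ultimately show ?thesis by simp
  qed
  let ?y = "\<lambda>K. half_point H' ((J - M) \<union> K)"
  let ?a = "1 / real (card Sol)"
  have cardSol: "0 < real (card Sol)" using finSol \<open>Sol \<noteq> {}\<close> by (simp add: card_gt_0_iff)
  have avg: "half_point H J = (\<Sum>K\<in>Sol. ?a *\<^sub>R ?y K)"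
  proof (rule vec_eqI)
    fix e assume e: "e \<in> E"
    have rhs: "(\<Sum>K\<in>Sol. ?a *\<^sub>R ?y K) $ idx e = ?a * (\<Sum>K\<in>Sol. ?y K $ idx e)"
      by (simp add: sum_component sum_distrib_left)
    show "half_point H J $ idx e = (\<Sum>K\<in>Sol. ?a *\<^sub>R ?y K) $ idx e"
    proof (cases "e \<in> M")
      case True
      have "(\<Sum>K\<in>Sol. ?y K $ idx e) = (\<Sum>K\<in>Sol. if e \<in> K then 1 else 0)"
        by (rule sum.cong) (use True e in \<open>auto simp: half_point_idx M_def H'_def\<close>)
      also have "\<dots> = real (card {K \<in> Sol. e \<in> K})"
        using finSol by (simp add: sum.If_cases Int_def)
      also have "\<dots> = real (card Sol) / 2" using half[OF True] by simp
      finally show ?thesis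
        using rhs True e cardSol by (simp add: half_point_idx M_def)
    next
      case False
      have "(\<Sum>K\<in>Sol. ?y K $ idx e) = (\<Sum>K\<in>Sol. half_point H J $ idx e)"
        by (rule sum.cong) (use False e in \<open>auto simp: half_point_idx M_def H'_def Sol_def\<close>)
      then show ?thesis using rhs cardSol by simp
    qed
  qed
  have states: "state (t + 2) f A' H' ((J - M) \<union> K)" if "K \<in> Sol" for K
  proof -
    have K: "K \<subseteq> M" "\<forall>v \<in> A - A'. odd_at K v \<longleftrightarrow> v \<in> T" using that by (auto simp: Sol_def)
    have finK: "finite K" using K(1) finM by (rule finite_subset)
    have "odd_at ((J - M) \<union> K) v" if v: "v \<in> V - A'" for v
    proof (cases "v \<in> A")
      case True
      have "(J - M) \<union> K = sym_diff (J - M) K" using K(1) by auto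
      then have "odd_at ((J - M) \<union> K) v \<longleftrightarrow> odd_at (J - M) v \<noteq> odd_at K v"
        using odd_at_sym_diff[of "J - M" K v] finJ finK by simp
      then show ?thesis using K(2) True v by (auto simp: T_def)
    next
      case False
      have "{e \<in> (J - M) \<union> K. v \<in> e} = {e \<in> J. v \<in> e}"
        using False K(1) HA unfolding M_def by blast
      moreover have "odd_at J v" using st v False by (auto simp: state_def)
      ultimately show ?thesis by (simp add: odd_at_def)
    qed
    moreover have "core (t + 2) f A' H'"
    proof -
      have "{e \<in> H'. e \<subseteq> A'} = {e \<in> H. e \<subseteq> A'}" by (auto simp: H'_def)
      then show ?thesis using core by (simp add: core_def lost_edges_def)
    qed
    ultimately show ?thesis
      using HE JE K(1) by (auto simp: state_def H'_def M_def)
  qed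
  have "(\<Sum>K\<in>Sol. ?a *\<^sub>R ?y K) \<in> convex hull {half_point H' J' | H' J'. state (t + 2) f A' H' J'}"
  proof (rule convex_sum[OF finSol convex_convex_hull])
    show "(\<Sum>K\<in>Sol. ?a) = 1" using cardSol by simp
    show "?y K \<in> convex hull {half_point H' J' | H' J'. state (t + 2) f A' H' J'}" if "K \<in> Sol" for K
      by (rule hull_inc) (use states[OF that] in blast)
  qed simp
  then show ?thesis using avg by simp
qed

text \<open>The \<open>t\<close> edges of \<open>D\<close> are charged to \<open>f\<close> and reduce the cuts from \<open>t + 2\<close> to 2. They lie inside
  \<open>A\<close>, so any rounding of them leaves the degrees outside \<open>A\<close> unchanged.\<close>

lemma state_fix_edges:
  assumes st: "state (t + 2) f A H J" and D: "D \<subseteq> H" "card D \<le> t"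
    and J': "J' \<subseteq> E" "J' - D = J - D"
  shows "state 2 (f + t) A (H - D) J'"
proof -
  have HE: "H \<subseteq> E" and HA: "\<And>e. e \<in> H \<Longrightarrow> e \<subseteq> A" using st by (auto simp: state_def)
  have finH: "finite H" using HE finite_E by (rule finite_subset)
  have finD: "finite D" using D(1) finH by (rule finite_subset)
  have "lost_edges A (H - D) \<subseteq> lost_edges A H \<union> D" by (auto simp: lost_edges_def)
  then have "card (lost_edges A (H - D)) \<le> card (lost_edges A H \<union> D)"
    by (intro card_mono) (auto simp: finite_lost_edges finD)
  also have "\<dots> \<le> card (lost_edges A H) + card D" by (rule card_Un_le)
  finally have "card (lost_edges A (H - D)) \<le> f + t + (t + 1) * card (V - A)"
    using st D(2) by (simp add: state_def core_def)
  moreover have "2 \<le> card (cut {e \<in> H - D. e \<subseteq> A} S)" if S: "S \<noteq> {}" "S \<subset> A" for S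
  proof -
    have "t + 2 \<le> card (cut H S)" using state_cut[OF st S] .
    moreover have "card (cut H S) - card D \<le> card (cut H S - D)" by (rule diff_card_le_card_Diff[OF finD])
    moreover have "cut {e \<in> H - D. e \<subseteq> A} S = cut H S - D" using HA by (auto simp: cut_def)
    ultimately show ?thesis using D(2) by simp
  qed
  moreover have "odd_at J' v" if v: "v \<in> V - A" for v
  proof -
    have "{e \<in> J'. v \<in> e} = {e \<in> J. v \<in> e}" using v J'(2) D(1) HA by blast
    moreover have "odd_at J v" using st v by (auto simp: state_def)
    ultimately show ?thesis by (simp add: odd_at_def)
  qed
  ultimately show ?thesis using st J'(1) by (auto simp: state_def core_def)
qed

lemma convex_lattice_closure: "convex (lattice_closure s Q)"
  unfolding lattice_closure_def by (intro convex_INT ballI convex_convex_hull)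

text \<open>The point is the midpoint of two points of \<open>Q\<close>, obtained by rounding \<open>D\<close> to ones and to zeros, that
  are integral for all given vectors. The set \<open>D\<close> depends on the vectors but these two roundings
  always satisfy the weaker invariant with cuts of size 2.\<close>

lemma state_survives_round:
  assumes st: "state (t + 2) f A H J"
    and step: "\<And>H' J'. state 2 (f + t) A H' J' \<Longrightarrow> half_point H' J' \<in> Q"
  shows "half_point H J \<in> lattice_closure t Q"
  unfolding lattice_closure_def
proof (rule INT_I)
  fix p :: "nat \<Rightarrow> real ^ 'n" assume "p \<in> {p. \<forall>j\<in>{1..t}. integral_vec (p j)}"
  then have p: "integral_vec (p j)" if "j \<in> {1..t}" for j using that by blast
  define w where "w j e = \<lfloor>p j $ idx e\<rfloor>" for j e
  have w: "p j $ idx e = of_int (w j e)" if "j \<in> {1..t}" for j e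
    using p[OF that] by (auto simp: w_def integral_vec_def)
  have HE: "H \<subseteq> E" and JE: "J \<subseteq> E" using st by (auto simp: state_def)
  have "finite H" using HE finite_E by (rule finite_subset)
  from exists_small_subset_even_rest[OF this, of t w]
  obtain D where D: "D \<subseteq> H" "card D \<le> t"
    and ev: "\<And>j. j \<in> {1..t} \<Longrightarrow> even (\<Sum>e \<in> H - D. w j e)" by blast
  let ?R = "\<Inter>j\<in>{1..t}. {x \<in> Q. p j \<bullet> x \<in> \<int>}"
  have mem: "half_point (H - D) J' \<in> ?R" if J': "J' \<subseteq> E" "J' - D = J - D" for J'
  proof -
    have "half_point (H - D) J' \<in> Q" by (rule step[OF state_fix_edges[OF st D J']])
    moreover have "p j \<bullet> half_point (H - D) J' \<in> \<int>" if "j \<in> {1..t}" for j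
      by (rule inner_half_point_Ints[OF _ w[OF that] ev[OF that]]) (use HE in auto)
    ultimately show ?thesis by blast
  qed
  have "half_point (H - D) (J \<union> D) \<in> ?R" "half_point (H - D) (J - D) \<in> ?R"
    by (rule mem; use D(1) HE JE in blast)+
  then have "(1/2) *\<^sub>R half_point (H - D) (J \<union> D) + (1/2) *\<^sub>R half_point (H - D) (J - D) \<in> convex hull ?R"
    by (intro convexD[OF convex_convex_hull] hull_inc) auto
  then show "half_point H J \<in> convex hull ?R"
    using half_point_split[OF D(1), of J] by simp
qed

text \<open>Each step first restores large cuts by passing to \<open>A'\<close>, then spends \<open>t\<close> half edges on the round.
  The last round is followed by no repair, so cuts of size 2 suffice at \<open>k = 0\<close>.\<close>

lemma state_in_iterated_closure:
  assumes "state 2 f A H J" "real f + real t * real k < budget"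
  shows "half_point H J \<in> (lattice_closure t ^^ k) P"
  using assms
proof (induction k arbitrary: f A H J)
  case 0
  then show ?case using state_in_P by simp
next
  case (Suc k)
  let ?Q = "(lattice_closure t ^^ k) P"
  have "real f + real t \<le> real f + real t * real (Suc k)" by (simp add: algebra_simps)
  then have "real f + real t < budget" using Suc.prems(2) by linarith
  moreover have "core 2 f A H" "H \<subseteq> E" using Suc.prems(1) by (auto simp: state_def)
  ultimately obtain A' where A': "A' \<subseteq> A" "core (t + 2) f A' H" using exists_core by blast
  have "half_point H' J' \<in> lattice_closure t ?Q" if "state (t + 2) f A' H' J'" for H' J'
  proof (rule state_survives_round[OF that])
    show "half_point H'' J'' \<in> ?Q" if "state 2 (f + t) A' H'' J''" for H'' J''
      by (rule Suc.IH[OF that]) (use Suc.prems(2) in \<open>simp add: algebra_simps\<close>)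
  qed
  then have "convex hull {half_point H' J' | H' J'. state (t + 2) f A' H' J'} \<subseteq> lattice_closure t ?Q"
    by (intro hull_minimal convex_lattice_closure) auto
  then show ?case
    using state_in_hull_of_core_states[OF Suc.prems(1) A'] by auto
qed

text \<open>The walk starts at the point with all entries 1/2. A cut of the whole graph has at least
  \<open>c\<close> edges, as the side with fewer vertices is nonempty.\<close>

lemma initial_state: "state 2 0 V E {}"
proof -
  have sub: "{e \<in> E. e \<subseteq> V} = E" using edge(1) by auto
  have "2 \<le> card (cut E S)" if S: "S \<noteq> {}" "S \<subset> V" for S
  proof -
    have large: "2 \<le> card (cut E X)" if X: "X \<subseteq> V" "X \<noteq> {}" "2 * card X \<le> card V" for X
    proof -
      have "finite X" using X(1) finite_V by (rule finite_subset)
      then have "1 \<le> real (card X)" using X(2) by (simp add: Suc_le_eq card_gt_0_iff)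
      then have "c * 1 \<le> c * real (card X)" using c_gt by (intro mult_left_mono) auto
      also have "\<dots> \<le> real (card (cut E X))" by (rule expansion[OF X])
      finally show ?thesis using c_gt t_pos by linarith
    qed
    show ?thesis
    proof (cases "2 * card S \<le> card V")
      case True
      then show ?thesis using large S by blast
    next
      case False
      have "card V = card S + card (V - S)"
        using card_Int_Diff[OF finite_V, of S] S by (simp add: Int_absorb1)
      then have "2 \<le> card (cut E (V - S))" using False S by (intro large) auto
      then show ?thesis using cut_compl[of S] S by simp
    qed
  qed
  moreover have "lost_edges V E = {}" using edge(1) by (auto simp: lost_edges_def)
  ultimately show ?thesis
    using edge(1) card_V_ge_2 by (auto simp: state_def core_def sub)
qed

lemma budget_le_lattice_rank: "ereal (budget / real t) \<le> ereal_of_enat (lattice_rank t P)"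
proof -
  have k: "budget / real t \<le> real k" if "(lattice_closure t ^^ k) P = integer_hull P" for k
  proof (rule ccontr)
    assume "\<not> ?thesis"
    then have "real 0 + real t * real k < budget"
      using t_pos by (simp add: field_simps)
    from state_in_iterated_closure[OF initial_state this]
    show False using that integer_hull_empty[OF odd_V] by simp
  qed
  let ?K = "{k. (lattice_closure t ^^ k) P = integer_hull P}"
  show ?thesis
  proof (cases "?K = {}")
    case True
    then show ?thesis by (simp add: lattice_rank_def top_enat_def)
  next
    case False
    then obtain k0 where "enat k0 \<in> enat ` ?K" by blast
    then have "(LEAST x. x \<in> enat ` ?K) \<in> enat ` ?K" by (rule LeastI)
    moreover have "lattice_rank t P = (LEAST x. x \<in> enat ` ?K)"
      unfolding lattice_rank_def Inf_enat_def using False by (intro if_not_P) blast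
    ultimately have "lattice_rank t P \<in> enat ` ?K" by simp
    then show ?thesis using k by auto
  qed
qed

end

section \<open>The rank bounds\<close>

lemma edge_expansion_le:
  assumes "finite V" "S \<subseteq> V" "S \<noteq> {}" "2 * card S \<le> card V"
    and edges: "\<And>e. e \<in> E \<Longrightarrow> e \<subseteq> V \<and> card e = 2"
  shows "edge_expansion V E * real (card S) \<le> real (card (cut E S))"
proof -
  let ?X = "{real (edges_between E S (V - S)) / real (card S) | S.
            S \<subseteq> V \<and> S \<noteq> {} \<and> real (card S) \<le> real (card V) / 2}"
  have "?X \<subseteq> (\<lambda>S. real (edges_between E S (V - S)) / real (card S)) ` Pow V" by auto
  then have "finite ?X" using assms(1) finite_subset by blast
  moreover have "real (edges_between E S (V - S)) / real (card S) \<in> ?X" using assms by auto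
  ultimately have le: "edge_expansion V E \<le> real (edges_between E S (V - S)) / real (card S)"
    unfolding edge_expansion_def by (rule Min_le)
  have "{e \<in> E. \<exists>u\<in>S. \<exists>v\<in>V - S. e = {u, v}} = cut E S"
  proof (intro equalityI subsetI)
    fix e assume "e \<in> cut E S"
    then obtain u v where uv: "e \<in> E" "u \<in> e" "u \<in> S" "v \<in> e" "v \<notin> S" by (auto simp: cut_def)
    then have "e = {u, v}" "v \<in> V" using edges[OF uv(1)] by (auto simp: card_2_iff)
    then show "e \<in> {e \<in> E. \<exists>u\<in>S. \<exists>v\<in>V - S. e = {u, v}}" using uv by blast
  qed (auto simp: cut_def)
  moreover have "0 < card S" using assms(1-3) finite_subset by (auto simp: card_gt_0_iff)
  ultimately show ?thesis using le by (simp add: edges_between_def field_simps)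
qed

theorem theorem1:
  fixes V :: "'v set" and E :: "'v set set" and idx :: "'v set \<Rightarrow> 'n::finite"
    and t :: nat and c :: real
  assumes "t \<ge> 1"
    and "simple_graph V E"
    and "odd (card V)"
    and "bij_betw idx E (UNIV :: 'n set)"
    and "c = edge_expansion V E"
    and "c > real t + 1"
  shows "ereal_of_enat (lattice_rank t (tseitin_polytope V E idx))
           \<ge> ereal ((c - (real t + 1)) / (2 * real t) * real (card V))
       \<and> (\<forall>d. regular_graph V E d \<longrightarrow>
             ereal_of_enat (lattice_rank t (tseitin_polytope V E idx))
               \<ge> ereal ((c - (real t + 1)) / (real d * real t) * real (card E)))"
proof -
  interpret tseitin_instance V E idx
    using assms by unfold_locales auto
  interpret expanding_tseitin V E idx t c
    using assms edge_expansion_le[OF finite_V] edge by unfold_locales auto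
  have bound: "ereal ((c - (real t + 1)) / (2 * real t) * real (card V)) \<le> ereal_of_enat (lattice_rank t P)"
    using budget_le_lattice_rank by (simp add: budget_def)
  have "ereal ((c - (real t + 1)) / (real d * real t) * real (card E)) \<le> ereal_of_enat (lattice_rank t P)"
    if reg: "regular_graph V E d" for d
  proof -
    have deg: "card {e \<in> E. v \<in> e} = d" if "v \<in> V" for v
      using card_nbrs_filter[OF that, of "\<lambda>_. True"] reg that
      by (simp add: regular_graph_def conj_commute)
    have "2 * card E = (\<Sum>v\<in>V. card {e \<in> E. v \<in> e})"
      by (rule sum_card_incident[symmetric]) (use finite_V finite_E edge in auto)
    also have "\<dots> = card V * d" by (simp add: deg)
    finally have "real (2 * card E) = real (card V * d)" by simp
    then have dE: "2 * real (card E) = real (card V) * real d" by simp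
    moreover have "0 < card E"
      using idx finite_E by (auto simp: card_gt_0_iff bij_betw_def)
    ultimately have "0 < real d" by (cases "d = 0") auto
    then have "(c - (real t + 1)) / (real d * real t) * real (card E)
      = (c - (real t + 1)) / (2 * real t) * real (card V)"
      using dE assms(1) by (simp add: field_simps)
    then show ?thesis using bound by simp
  qed
  then show ?thesis using bound by blast
qed

end
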